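(* Let $V$ and $Q$ be real separable Hilbert spaces and $B\in L(V,Q')$. The following three properties are equivalent: (a) There exists $\Theta\in L(Q,V)$ which is onto and satisfies $\langle B^*p,\Theta p\rangle_{V',V}\ge\|p\|_Q^2$ for all $p\in Q$. (b) $B$ satisfies an inf-sup condition: there exists $\gamma>0$ such that $$\inf_{p\in Q\setminus\{0\}}\sup_{v\in V\setminus\{0\}}\frac{\langle Bv,p\rangle_{Q',Q}}{\|v\|_V\|p\|_Q}\ge\gamma .$$ (c) $B$ is an isomorphism from $(\operatorname{Ker}B)^\perp$ to $Q'$ and there is a constant $c_B\ge0$ with $\|v\|_V\le c_B\|Bv\|_{Q'}$ for all $v\in(\operatorname{Ker}B)^\perp$.
   Context: $L(\cdot,\cdot)$ denotes bounded linear operators; $B^*\in L(Q,V')$ is defined by $\langle B^*p,v\rangle_{V',V}=\langle Bv,p\rangle_{Q',Q}$; $(\operatorname{Ker}B)^\perp$ is the orthogonal complement in $V$.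
   Formalization: In (a), "onto" is read as onto (Ker B)^⊥ rather than onto V; with onto V the equivalence fails, e.g. V=R², Q=R, ⟨Bv,p⟩=v₁p satisfies (b) and (c) but no linear Θ: R→R² is onto; the two readings agree when Ker B=0. *)

theory Defs
  imports "HOL-Analysis.Analysis"
begin

text \<open>The dual \<open>Q'\<close> of a real normed space is the type \<open>'q \<Rightarrow>\<^sub>L real\<close> with its operator norm,
  and the pairing \<open>\<langle>f, p\<rangle>\<close> of \<open>Q'\<close> with \<open>Q\<close> is \<open>blinfun_apply f p\<close>.\<close>

definition dual_map ::
  "('v::real_normed_vector \<Rightarrow>\<^sub>L ('q::real_normed_vector \<Rightarrow>\<^sub>L real)) \<Rightarrow> ('q \<Rightarrow>\<^sub>L ('v \<Rightarrow>\<^sub>L real))"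
  where "dual_map B = Blinfun (\<lambda>p. Blinfun (\<lambda>v. B v p))"

text \<open>The bounded linearity needed for \<^const>\<open>Blinfun\<close> to be meaningful holds for every \<open>B\<close>:\<close>

lemma dual_map_apply: "dual_map B p v = B v p"
proof -
  have bil: "bounded_bilinear (\<lambda>v. blinfun_apply (B v))"
    by (rule bounded_bilinear.comp1[OF bounded_bilinear_blinfun_apply blinfun.bounded_linear_right])
  have inner: "blinfun_apply (Blinfun (\<lambda>v. B v p)) = (\<lambda>v. B v p)" for p
    by (rule bounded_linear_Blinfun_apply[OF bounded_bilinear.bounded_linear_left[OF bil]])
  obtain K where K: "\<And>v p. norm (B v p) \<le> norm v * norm p * K" "0 \<le> K"
    using bounded_bilinear.nonneg_bounded[OF bil] by blast
  have "bounded_linear (\<lambda>p. Blinfun (\<lambda>v. B v p))"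
  proof (rule bounded_linear_intro[where K = K])
    fix p :: 'b
    show "norm (Blinfun (\<lambda>v. B v p)) \<le> norm p * K"
      by (rule norm_blinfun_bound) (use K in \<open>simp_all add: inner mult_ac\<close>)
  next
    fix p q :: 'b
    show "Blinfun (\<lambda>v. B v (p + q)) = Blinfun (\<lambda>v. B v p) + Blinfun (\<lambda>v. B v q)"
      by (rule blinfun_eqI) (simp only: inner plus_blinfun.rep_eq, simp only: blinfun.add_right)
  next
    fix r and p :: 'b
    show "Blinfun (\<lambda>v. B v (r *\<^sub>R p)) = r *\<^sub>R Blinfun (\<lambda>v. B v p)"
      by (rule blinfun_eqI) (simp only: inner scaleR_blinfun.rep_eq, simp only: blinfun.scaleR_right)
  qed
  then show ?thesis
    by (simp add: dual_map_def bounded_linear_Blinfun_apply inner)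
qed

definition ker :: "('v::real_normed_vector \<Rightarrow>\<^sub>L 'w::real_normed_vector) \<Rightarrow> 'v set"
  where "ker T = {v. T v = 0}"

text \<open>\<open>T\<close> restricts to an isomorphism of normed spaces from the subspace \<open>S\<close> onto the whole
  target space: a bijection, continuous in both directions (linearity of \<open>T\<close>, hence of the
  inverse, is built into the type of \<open>T\<close>).\<close>

definition isomorphism_from ::
  "('v::real_normed_vector \<Rightarrow>\<^sub>L 'w::real_normed_vector) \<Rightarrow> 'v set \<Rightarrow> bool"
  where "isomorphism_from T S \<longleftrightarrow> (\<exists>G. homeomorphism S UNIV (blinfun_apply T) G)"

text \<open>Infimum and supremum are taken in the extended reals, so that the infimum over the empty set
  (\<open>Q = 0\<close>) is \<open>+\<infinity>\<close> and the supremum over the empty set (\<open>V = 0\<close>) is \<open>-\<infinity>\<close>.\<close>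

definition inf_sup ::
  "('v::real_normed_vector \<Rightarrow>\<^sub>L ('q::real_normed_vector \<Rightarrow>\<^sub>L real)) \<Rightarrow> ereal"
  where "inf_sup B =
    (INF p \<in> UNIV - {0}. SUP v \<in> UNIV - {0}. ereal (B v p / (norm v * norm p)))"

text \<open>In property (a) of the theorem, ``onto'' means onto \<open>(Ker B)\<^sup>\<bottom>\<close>, not onto all of \<open>V\<close>.
  The inequality in (a) makes \<open>B \<circ> \<Theta>\<close> injective, so a \<open>\<Theta>\<close> onto \<open>V\<close> exists only if
  \<open>Ker B = 0\<close>, in which case the two readings coincide; but (b) and (c) also hold for
  operators with a nontrivial kernel, e.g. \<open>V = \<real>\<^sup>2\<close>, \<open>Q = \<real>\<close>, \<open>\<langle>Bv, p\<rangle> = v\<^sub>1 p\<close>.\<close>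

end

theory Submission
  imports Defs
begin

text \<open>By Riesz representation, \<open>\<langle>Bv, p\<rangle> = A v \<bullet> p = v \<bullet> A' p\<close> with \<open>A : V \<rightarrow> Q\<close> and its adjoint \<open>A'\<close>.
  The inf-sup condition says \<open>\<parallel>A' p\<parallel> \<ge> \<gamma> \<parallel>p\<parallel>\<close>, so that \<open>A A'\<close> is coercive and hence onto
  (Lax--Milgram). Thus every \<open>q\<close> is \<open>A v\<close> with \<open>v = A' p\<close>, an element of \<open>(Ker B)\<^sup>\<bottom>\<close>, and
  \<open>\<parallel>v\<parallel>\<^sup>2 = \<langle>Bv, p\<rangle> \<le> \<parallel>Bv\<parallel> \<parallel>v\<parallel> / \<gamma>\<close>; moreover \<open>\<Theta> = A' / \<gamma>\<^sup>2\<close> does for (a). Conversely, both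
  \<open>\<Theta> p\<close> in (a) and the preimage of \<open>p \<bullet> _\<close> in (c) are vectors \<open>v\<close> with \<open>\<langle>Bv, p\<rangle> \<ge> \<parallel>p\<parallel>\<^sup>2\<close> and
  \<open>\<parallel>v\<parallel> \<le> C \<parallel>p\<parallel>\<close>, which test the supremum.\<close>

section \<open>Riesz representation and the Lax--Milgram lemma\<close>

text \<open>At \<open>t = - b / n\<close>, for a positive \<open>n \<ge> a\<close>, the quadratic is
  at most \<open>- (b\<^sup>2 / n)\<close>. This is the first-order condition at a
  minimiser.\<close>

lemma linear_coeff_zero_if_quadratic_nonneg:
  fixes a b :: real
  assumes "\<And>t. 0 \<le> t\<^sup>2 * a + 2 * t * b"
  shows "b = 0"
proof -
  define n where "n = \<bar>a\<bar> + 1"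
  have "0 < n" "a \<le> n"
    by (auto simp: n_def)
  have "0 \<le> (- b / n)\<^sup>2 * a + 2 * (- b / n) * b"
    by (rule assms)
  also have "\<dots> \<le> (- b / n)\<^sup>2 * n + 2 * (- b / n) * b"
    using \<open>a \<le> n\<close> by (intro add_right_mono mult_left_mono) auto
  also have "\<dots> = - (b\<^sup>2 / n)"
    using \<open>0 < n\<close> by (simp add: power2_eq_square field_simps)
  finally show ?thesis
    using \<open>0 < n\<close> by (simp add: divide_le_0_iff)
qed

text \<open>The representing vector is the minimiser of \<open>J x = \<parallel>x\<parallel>\<^sup>2 - 2 f x\<close>; minimising sequences are
  Cauchy by the parallelogram law.\<close>

lemma riesz_representation:
  fixes f :: "'a::{real_inner, complete_space} \<Rightarrow>\<^sub>L real"
  obtains z where "\<And>x. f x = z \<bullet> x"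
proof -
  define J where "J x = (norm x)\<^sup>2 - 2 * f x" for x
  have J_lower: "- (norm f)\<^sup>2 \<le> J x" for x
  proof -
    have "f x \<le> norm f * norm x"
      using norm_blinfun[of f x] by auto
    moreover have "0 \<le> (norm x - norm f)\<^sup>2"
      by simp
    ultimately show ?thesis
      unfolding J_def power2_diff by (simp only: mult_ac)
  qed
  define m where "m = (INF x. J x)"
  have bdd: "bdd_below (range J)"
    using J_lower by (rule bdd_belowI2)
  have m_le: "m \<le> J x" for x
    unfolding m_def by (rule cINF_lower[OF bdd]) simp
  have "\<exists>x. J x < m + inverse (Suc n)" for n
    using cINF_less_iff[OF _ bdd, of "m + inverse (Suc n)"] unfolding m_def by simp
  then obtain x where x: "\<And>n. J (x n) < m + inverse (Suc n)"
    by metis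
  \<comment> \<open>The parallelogram law reads \<open>J u + J v - 2 * J ((1/2) *\<^sub>R (u + v)) =
    (norm (u - v))\<^sup>2 / 2\<close>, and \<open>m\<close> bounds \<open>J\<close> at the
    midpoint.\<close>
  have para: "(norm (u - v))\<^sup>2 \<le> 2 * (J u - m) + 2 * (J v - m)" for u v
  proof -
    have "4 * J ((1/2) *\<^sub>R (u + v)) = (norm (u + v))\<^sup>2 - 4 * (f u + f v)"
    proof -
      have "f ((1/2) *\<^sub>R (u + v)) = (f u + f v) / 2"
        by (simp only: blinfun.scaleR_right blinfun.add_right) simp
      moreover have "(norm ((1/2) *\<^sub>R (u + v)))\<^sup>2 = (norm (u + v))\<^sup>2 / 4"
        by (simp add: power_divide)
      ultimately show ?thesis
        unfolding J_def by argo
    qed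
    moreover have "(norm (u + v))\<^sup>2 + (norm (u - v))\<^sup>2 = 2 * (norm u)\<^sup>2 + 2 * (norm v)\<^sup>2"
      by (simp add: power2_norm_eq_inner algebra_simps inner_commute)
    ultimately show ?thesis
      using m_le[of "(1/2) *\<^sub>R (u + v)"] unfolding J_def by simp
  qed
  have "Cauchy x"
  proof (rule metric_CauchyI)
    fix e :: real
    assume "0 < e"
    then obtain N where N: "inverse (Suc N) < e\<^sup>2 / 4"
      using reals_Archimedean[of "e\<^sup>2 / 4"] by auto
    have "dist (x i) (x j) < e" if "N \<le> i" "N \<le> j" for i j
    proof -
      have small: "J (x k) - m < e\<^sup>2 / 4" if "N \<le> k" for k
      proof -
        have "inverse (real (Suc k)) \<le> inverse (Suc N)"
          using that by (intro le_imp_inverse_le) auto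
        with x[of k] N show ?thesis
          by linarith
      qed
      have "(norm (x i - x j))\<^sup>2 < e\<^sup>2"
        using para[of "x i" "x j"] small[OF \<open>N \<le> i\<close>] small[OF \<open>N \<le> j\<close>] by argo
      then show ?thesis
        using \<open>0 < e\<close> by (auto simp: dist_norm intro: power_less_imp_less_base)
    qed
    then show "\<exists>M. \<forall>i\<ge>M. \<forall>j\<ge>M. dist (x i) (x j) < e"
      by blast
  qed
  then obtain z where z: "x \<longlonglongrightarrow> z"
    using Cauchy_convergent convergent_def by blast
  have "(\<lambda>n. J (x n)) \<longlonglongrightarrow> J z"
    unfolding J_def by (intro tendsto_intros z)
  moreover have "(\<lambda>n. m + inverse (real (Suc n))) \<longlonglongrightarrow> m + 0"
    by (intro tendsto_add tendsto_const LIMSEQ_inverse_real_of_nat)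
  ultimately have "J z \<le> m + 0"
    by (rule LIMSEQ_le) (use x less_imp_le in blast)
  then have z_min: "J z \<le> J y" for y
    using m_le[of y] by simp
  \<comment> \<open>Moving from \<open>z\<close> along \<open>y\<close> changes \<open>J\<close> by
    a nonnegative quadratic in \<open>t\<close>.\<close>
  have "z \<bullet> y - f y = 0" for y
  proof (rule linear_coeff_zero_if_quadratic_nonneg)
    fix t :: real
    have "J (z + t *\<^sub>R y) = J z + (t\<^sup>2 * (norm y)\<^sup>2 + 2 * t * (z \<bullet> y - f y))"
      unfolding J_def power2_norm_eq_inner
      by (simp add: inner_commute blinfun.scaleR_right blinfun.add_right power2_eq_square algebra_simps)
    with z_min[of "z + t *\<^sub>R y"] show "0 \<le> t\<^sup>2 * (norm y)\<^sup>2 + 2 * t * (z \<bullet> y - f y)"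
      by simp
  qed
  then show thesis
    using that[of z] by simp
qed

text \<open>Uniqueness of the Riesz vectors makes \<open>A\<close> linear; testing
  \<open>T v\<close> with \<open>A v\<close> itself bounds it. Applied to \<open>dual_map B\<close>,
  it yields the adjoint.\<close>

lemma riesz_representation_operator:
  fixes T :: "'a::real_normed_vector \<Rightarrow>\<^sub>L ('b::{real_inner, complete_space} \<Rightarrow>\<^sub>L real)"
  obtains A :: "'a \<Rightarrow>\<^sub>L 'b" where "\<And>v p. T v p = A v \<bullet> p"
proof -
  have "\<exists>z. \<forall>p. T v p = z \<bullet> p" for v
    by (rule riesz_representation[of "T v"]) blast
  then obtain A where A: "\<And>v p. T v p = A v \<bullet> p"
    by metis
  have "bounded_linear A"
  proof (rule bounded_linear_intro[where K = "norm T"])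
    show "A (v + w) = A v + A w" for v w
      by (subst vector_eq_rdot[symmetric])
        (simp add: inner_add_left blinfun.add_right plus_blinfun.rep_eq flip: A)
    show "A (r *\<^sub>R v) = r *\<^sub>R A v" for r v
      by (subst vector_eq_rdot[symmetric])
        (simp add: blinfun.scaleR_right scaleR_blinfun.rep_eq flip: A)
    show "norm (A v) \<le> norm v * norm T" for v
    proof (cases "A v = 0")
      case False
      have "(norm (A v))\<^sup>2 = T v (A v)"
        by (simp add: A power2_norm_eq_inner)
      also have "\<dots> \<le> norm (T v) * norm (A v)"
        using norm_blinfun[of "T v" "A v"] by auto
      finally have "norm (A v) \<le> norm (T v)"
        using False by (simp add: power2_eq_square)
      also have "\<dots> \<le> norm v * norm T"
        using norm_blinfun[of T v] by (simp add: mult.commute)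
      finally show ?thesis .
    qed simp
  qed
  with A show thesis
    by (intro that[of "Blinfun A"]) (simp add: bounded_linear_Blinfun_apply)
qed

text \<open>The solution of \<open>S p = q\<close> is the fixed point of \<open>p \<mapsto> p - r (S p - q)\<close>, a contraction for
  small \<open>r > 0\<close>.\<close>

lemma coercive_imp_surj:
  fixes S :: "'a::{real_inner, complete_space} \<Rightarrow>\<^sub>L 'a"
  assumes "0 < c" and coercive: "\<And>p. c * (norm p)\<^sup>2 \<le> S p \<bullet> p"
  shows "surj S"
proof -
  \<comment> \<open>This \<open>r\<close> minimises
    \<open>1 - 2 * r * c + r\<^sup>2 * K\<^sup>2\<close>, with minimum \<open>k\<^sup>2\<close>.
    Adding \<open>c\<close> to \<open>norm S\<close> ensures \<open>0 < K\<close> and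
    \<open>c \<le> K\<close>, so the root is real.\<close>
  define K where "K = norm S + c"
  define r where "r = c / K\<^sup>2"
  define k where "k = sqrt (1 - c\<^sup>2 / K\<^sup>2)"
  have "c \<le> K" "0 < K" "norm S \<le> K"
    using \<open>0 < c\<close> by (auto simp: K_def add_nonneg_pos)
  have "0 < r"
    using \<open>0 < c\<close> \<open>0 < K\<close> by (simp add: r_def)
  have "0 < c\<^sup>2 / K\<^sup>2" "c\<^sup>2 / K\<^sup>2 \<le> 1"
    using \<open>0 < c\<close> \<open>c \<le> K\<close> \<open>0 < K\<close> by (auto simp: divide_le_eq power_mono)
  then have k: "0 \<le> k" "k < 1" "k\<^sup>2 = 1 - c\<^sup>2 / K\<^sup>2"
    by (auto simp: k_def)
  have contr: "norm (p - r *\<^sub>R S p) \<le> k * norm p" for p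
  proof (rule power2_le_imp_le)
    have "norm (S p) \<le> K * norm p"
      using norm_blinfun[of S p] mult_right_mono[OF \<open>norm S \<le> K\<close>, of "norm p"] by simp
    then have "(norm (S p))\<^sup>2 \<le> (K * norm p)\<^sup>2"
      by (rule power_mono) simp
    then have Sp: "r\<^sup>2 * (norm (S p))\<^sup>2 \<le> r\<^sup>2 * (K * norm p)\<^sup>2"
      by (rule mult_left_mono) simp
    have "(norm (p - r *\<^sub>R S p))\<^sup>2 = (norm p)\<^sup>2 - 2 * r * (S p \<bullet> p) + r\<^sup>2 * (norm (S p))\<^sup>2"
      unfolding power2_norm_eq_inner by (simp add: algebra_simps inner_commute power2_eq_square)
    also have "\<dots> \<le> (norm p)\<^sup>2 - 2 * r * (c * (norm p)\<^sup>2) + r\<^sup>2 * (K * norm p)\<^sup>2"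
      using Sp mult_left_mono[OF coercive[of p], of "2 * r"] \<open>0 < r\<close> by linarith
    also have "\<dots> = (k * norm p)\<^sup>2"
      unfolding power_mult_distrib k(3) r_def using \<open>0 < K\<close>
      by (simp add: field_simps power2_eq_square)
    finally show "(norm (p - r *\<^sub>R S p))\<^sup>2 \<le> (k * norm p)\<^sup>2" .
  qed (simp add: k)
  have "\<exists>p. q = S p" for q
  proof -
    define F where "F p = p - r *\<^sub>R (S p - q)" for p
    have "dist (F u) (F v) \<le> k * dist u v" for u v
    proof -
      have "F u - F v = (u - v) - r *\<^sub>R S (u - v)"
        by (simp add: F_def blinfun.diff_right algebra_simps)
      then show ?thesis
        using contr[of "u - v"] by (simp add: dist_norm)
    qed
    then have "\<exists>!p. F p = p"
      using k by (intro banach_fix_type[where c = k]) auto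
    then obtain p where "F p = p"
      by blast
    then show ?thesis
      using \<open>0 < r\<close> by (auto simp: F_def)
  qed
  then show ?thesis
    by (auto simp: surj_def)
qed

section \<open>The inf-sup condition\<close>

text \<open>The vector \<open>v\<close> tests the supremum: its quotient is at least
  \<open>(norm p)\<^sup>2 / (C * (norm p)\<^sup>2)\<close>.\<close>

lemma inf_sup_geI:
  fixes B :: "'v::real_normed_vector \<Rightarrow>\<^sub>L ('q::real_normed_vector \<Rightarrow>\<^sub>L real)"
  assumes "0 < C" and "\<And>p. \<exists>v. norm v \<le> C * norm p \<and> (norm p)\<^sup>2 \<le> B v p"
  shows "ereal (1 / C) \<le> inf_sup B"
  unfolding inf_sup_def
proof (rule INF_greatest)
  fix p :: 'q
  assume "p \<in> UNIV - {0}"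
  then have "0 < norm p"
    by simp
  obtain v where v: "norm v \<le> C * norm p" "(norm p)\<^sup>2 \<le> B v p"
    using assms by blast
  have "v \<noteq> 0"
    using v(2) \<open>0 < norm p\<close> by (auto simp: blinfun.zero_left)
  have "norm v * norm p \<le> C * B v p"
  proof -
    have "norm v * norm p \<le> C * norm p * norm p"
      using v(1) by (rule mult_right_mono) simp
    also have "\<dots> = C * (norm p)\<^sup>2"
      by (simp add: power2_eq_square)
    also have "\<dots> \<le> C * B v p"
      using v(2) \<open>0 < C\<close> by simp
    finally show ?thesis .
  qed
  then have "1 / C \<le> B v p / (norm v * norm p)"
    using \<open>0 < C\<close> \<open>0 < norm p\<close> \<open>v \<noteq> 0\<close> by (simp add: field_simps)
  with \<open>v \<noteq> 0\<close> show "ereal (1 / C) \<le> (SUP v \<in> UNIV - {0}. ereal (B v p / (norm v * norm p)))"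
    by (intro SUP_upper2[of v]) auto
qed

text \<open>By Cauchy-Schwarz no quotient exceeds \<open>norm (A' p) / norm p\<close>.\<close>

lemma inf_sup_imp_adjoint_bounded_below:
  fixes B :: "'v::real_inner \<Rightarrow>\<^sub>L ('q::real_normed_vector \<Rightarrow>\<^sub>L real)" and A' :: "'q \<Rightarrow> 'v"
  assumes "ereal \<gamma> \<le> inf_sup B" and A': "\<And>v p. B v p = A' p \<bullet> v"
  shows "\<gamma> * norm p \<le> norm (A' p)"
proof (cases "p = 0")
  case False
  then have "ereal \<gamma> \<le> (SUP v \<in> UNIV - {0}. ereal (B v p / (norm v * norm p)))"
    using assms(1) unfolding inf_sup_def by (auto simp: le_INF_iff)
  also have "\<dots> \<le> ereal (norm (A' p) / norm p)"
  proof (rule SUP_least)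
    fix v :: 'v
    assume "v \<in> UNIV - {0}"
    then show "ereal (B v p / (norm v * norm p)) \<le> ereal (norm (A' p) / norm p)"
      using False norm_cauchy_schwarz[of "A' p" v] by (simp add: A' field_simps)
  qed
  finally show ?thesis
    using False by (simp add: field_simps)
qed simp

text \<open>Up to Riesz, \<open>p \<mapsto> B (A' p)\<close> is \<open>A o\<^sub>L A'\<close>, which
  is coercive because \<open>A (A' p) \<bullet> p = (norm (A' p))\<^sup>2\<close>.\<close>

lemma inf_sup_imp_right_inverse:
  fixes B :: "'v::{real_inner, complete_space} \<Rightarrow>\<^sub>L ('q::{real_inner, complete_space} \<Rightarrow>\<^sub>L real)"
    and A' :: "'q \<Rightarrow>\<^sub>L 'v"
  assumes "0 < \<gamma>" "ereal \<gamma> \<le> inf_sup B" and A': "\<And>v p. B v p = A' p \<bullet> v"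
  shows "\<exists>p. B (A' p) = g"
proof -
  obtain A :: "'v \<Rightarrow>\<^sub>L 'q" where A: "\<And>v p. B v p = A v \<bullet> p"
    using riesz_representation_operator[of B] by blast
  have "\<gamma>\<^sup>2 * (norm p)\<^sup>2 \<le> (A o\<^sub>L A') p \<bullet> p" for p
  proof -
    have "(\<gamma> * norm p)\<^sup>2 \<le> (norm (A' p))\<^sup>2"
      using inf_sup_imp_adjoint_bounded_below[OF assms(2) A'] \<open>0 < \<gamma>\<close> by (intro power_mono) auto
    also have "\<dots> = A (A' p) \<bullet> p"
      by (simp add: power2_norm_eq_inner flip: A A')
    finally show ?thesis
      by (simp add: power_mult_distrib)
  qed
  then have "surj (A o\<^sub>L A')"
    using \<open>0 < \<gamma>\<close> by (intro coercive_imp_surj[where c = "\<gamma>\<^sup>2"]) auto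
  moreover obtain q where "\<And>x. g x = q \<bullet> x"
    using riesz_representation[of g] by blast
  ultimately show ?thesis
    by (metis A blinfun_apply_blinfun_compose blinfun_eqI surjD)
qed

section \<open>The orthogonal complement of the kernel\<close>

text \<open>For the harder inclusion, subtract from \<open>v\<close> some \<open>A' p\<close> with
  the same image under \<open>B\<close>: the difference lies in both the kernel and its
  complement.\<close>

lemma range_adjoint_eq_orthogonal_ker:
  fixes B :: "'v::real_inner \<Rightarrow>\<^sub>L ('q::real_normed_vector \<Rightarrow>\<^sub>L real)" and A' :: "'q \<Rightarrow> 'v"
  assumes A': "\<And>v p. B v p = A' p \<bullet> v" and ex: "\<And>g. \<exists>p. B (A' p) = g"
  shows "range A' = (ker B)\<^sup>\<bottom>"
proof
  show sub: "range A' \<subseteq> (ker B)\<^sup>\<bottom>"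
    by (auto simp: orthogonal_comp_def orthogonal_def ker_def inner_commute[of _ "A' _"]
        simp flip: A')
  show "(ker B)\<^sup>\<bottom> \<subseteq> range A'"
  proof
    fix v
    assume v: "v \<in> (ker B)\<^sup>\<bottom>"
    obtain p where "B (A' p) = B v"
      using ex by blast
    then have "v - A' p \<in> ker B"
      by (simp add: ker_def blinfun.diff_right)
    moreover have "v - A' p \<in> (ker B)\<^sup>\<bottom>"
      using v sub by (intro subspace_diff[OF subspace_orthogonal_comp]) auto
    ultimately have "v - A' p = 0"
      by (auto simp: orthogonal_comp_def orthogonal_def)
    then show "v \<in> range A'"
      by simp
  qed
qed

text \<open>Applied to differences, the bound gives injectivity and a Lipschitz inverse.\<close>

lemma isomorphism_from_orthogonal_kerI:
  fixes B :: "'v::real_inner \<Rightarrow>\<^sub>L 'w::real_normed_vector"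
  assumes surj: "\<And>g. \<exists>v \<in> (ker B)\<^sup>\<bottom>. B v = g"
    and bound: "\<And>v. v \<in> (ker B)\<^sup>\<bottom> \<Longrightarrow> norm v \<le> c * norm (B v)"
  shows "isomorphism_from B ((ker B)\<^sup>\<bottom>)"
proof -
  obtain G where G: "\<And>g. G g \<in> (ker B)\<^sup>\<bottom>" "\<And>g. B (G g) = g"
    using surj by metis
  have lip: "norm (v - w) \<le> c * norm (B v - B w)" if "v \<in> (ker B)\<^sup>\<bottom>" "w \<in> (ker B)\<^sup>\<bottom>" for v w
    using bound[OF subspace_diff[OF subspace_orthogonal_comp that]] by (simp add: blinfun.diff_right)
  have "continuous_on UNIV G"
  proof (rule continuous_on_subset[OF lipschitz_on_continuous_on])
    \<comment> \<open>A Lipschitz constant must be nonnegative, and the sign of \<open>c\<close> is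
      unknown.\<close>
    show "\<bar>c\<bar>-lipschitz_on UNIV G"
    proof (rule lipschitz_onI)
      fix g h
      have "norm (G g - G h) \<le> c * norm (g - h)"
        using lip[OF G(1) G(1), of g h] by (simp add: G(2))
      also have "\<dots> \<le> \<bar>c\<bar> * norm (g - h)"
        by (intro mult_right_mono) auto
      finally show "dist (G g) (G h) \<le> \<bar>c\<bar> * dist g h"
        by (simp add: dist_norm)
    qed simp
  qed simp
  moreover have "G (B v) = v" if "v \<in> (ker B)\<^sup>\<bottom>" for v
    using lip[OF G(1) that, of "B v"] by (simp add: G(2))
  ultimately have "homeomorphism ((ker B)\<^sup>\<bottom>) UNIV B G"
    unfolding homeomorphism_def
    using G by (auto simp: image_iff intro!: linear_continuous_on blinfun.bounded_linear_right) metis+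
  then show ?thesis
    unfolding isomorphism_from_def by blast
qed

section \<open>Equivalence of (a), (b) and (c), with (b) as the hub\<close>

theorem lemma3p3:
  fixes B :: "'v::{real_inner, complete_space} \<Rightarrow>\<^sub>L ('q::{real_inner, complete_space} \<Rightarrow>\<^sub>L real)"
  assumes "separable_space (euclidean :: 'v topology)"
    and "separable_space (euclidean :: 'q topology)"
  shows
    "((\<exists>\<Theta> :: 'q \<Rightarrow>\<^sub>L 'v. range (blinfun_apply \<Theta>) = (ker B)\<^sup>\<bottom> \<and>
         (\<forall>p. dual_map B p (\<Theta> p) \<ge> (norm p)\<^sup>2))
      \<longleftrightarrow> (\<exists>\<gamma>::real. \<gamma> > 0 \<and> inf_sup B \<ge> ereal \<gamma>))
     \<and>
     ((\<exists>\<gamma>::real. \<gamma> > 0 \<and> inf_sup B \<ge> ereal \<gamma>)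
      \<longleftrightarrow> (isomorphism_from B ((ker B)\<^sup>\<bottom>) \<and>
         (\<exists>c\<^sub>B::real. c\<^sub>B \<ge> 0 \<and> (\<forall>v \<in> (ker B)\<^sup>\<bottom>. norm v \<le> c\<^sub>B * norm (B v)))))"
    (is "(?a \<longleftrightarrow> ?b) \<and> (?b \<longleftrightarrow> ?c)")
proof -
  obtain A' :: "'q \<Rightarrow>\<^sub>L 'v" where "\<And>p v. dual_map B p v = A' p \<bullet> v"
    using riesz_representation_operator[of "dual_map B"] by blast
  then have A': "B v p = A' p \<bullet> v" for v p
    by (simp add: dual_map_apply)
  have "?b" if ?a
  proof -
    from that obtain \<Theta> :: "'q \<Rightarrow>\<^sub>L 'v" where \<Theta>: "\<And>p. (norm p)\<^sup>2 \<le> B (\<Theta> p) p"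
      by (auto simp: dual_map_apply)
    \<comment> \<open>Adding 1 keeps the constant positive even for
      \<open>\<Theta> = 0\<close>.\<close>
    have "norm (\<Theta> p) \<le> (norm \<Theta> + 1) * norm p" for p
      using norm_blinfun[of \<Theta> p] by (simp add: distrib_right add_increasing2)
    with \<Theta> have "ereal (1 / (norm \<Theta> + 1)) \<le> inf_sup B"
      by (intro inf_sup_geI) (auto simp: add_nonneg_pos)
    then show ?b
      by (intro exI[of _ "1 / (norm \<Theta> + 1)"]) (simp add: add_nonneg_pos)
  qed
  moreover have "?a \<and> ?c" if ?b
  proof -
    from that obtain \<gamma> where \<gamma>: "0 < \<gamma>" "ereal \<gamma> \<le> inf_sup B"
      by blast
    have ex: "\<exists>p. B (A' p) = g" for g
      by (rule inf_sup_imp_right_inverse[OF \<gamma> A'])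
    have lower: "\<gamma> * norm p \<le> norm (A' p)" for p
      by (rule inf_sup_imp_adjoint_bounded_below[OF \<gamma>(2) A'])
    have range: "range A' = (ker B)\<^sup>\<bottom>"
      by (rule range_adjoint_eq_orthogonal_ker[OF A' ex])
    \<comment> \<open>The pairing of \<open>B (A' p)\<close> with \<open>p\<close> is \<open>(norm
      (A' p))\<^sup>2 \<ge> \<gamma>\<^sup>2 * (norm p)\<^sup>2\<close>, so dividing by
      \<open>\<gamma>\<^sup>2\<close> normalises the bound in (a).\<close>
    define \<Theta> where "\<Theta> = (1 / \<gamma>\<^sup>2) *\<^sub>R A'"
    have \<Theta>: "\<Theta> p = A' ((1 / \<gamma>\<^sup>2) *\<^sub>R p)" for p
      by (simp add: \<Theta>_def scaleR_blinfun.rep_eq blinfun.scaleR_right)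
    have "surj (\<lambda>p::'q. (1 / \<gamma>\<^sup>2) *\<^sub>R p)"
      using \<gamma>(1) by (intro surjI[where f = "\<lambda>p. \<gamma>\<^sup>2 *\<^sub>R p"]) simp
    then have "range \<Theta> = range A'"
      unfolding \<Theta> by (metis image_image)
    moreover have "(norm p)\<^sup>2 \<le> B (\<Theta> p) p" for p
    proof -
      have "(\<gamma> * norm p)\<^sup>2 \<le> (norm (A' p))\<^sup>2"
        using lower \<gamma>(1) by (intro power_mono) auto
      also have "\<dots> = \<gamma>\<^sup>2 * B (\<Theta> p) p"
        using \<gamma>(1) by (simp add: A' \<Theta> power2_norm_eq_inner blinfun.scaleR_right[of A'])
      finally show ?thesis
        using \<gamma>(1) by (simp add: power_mult_distrib)
    qed
    ultimately have ?a
      using range by (auto simp: dual_map_apply)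
    have bound: "norm v \<le> (1 / \<gamma>) * norm (B v)" if "v \<in> (ker B)\<^sup>\<bottom>" for v
    proof -
      obtain p where p: "v = A' p"
        using \<open>v \<in> (ker B)\<^sup>\<bottom>\<close> range by blast
      \<comment> \<open>Since \<open>v = A' p\<close>, pairing \<open>B v\<close> with
        \<open>p\<close> gives \<open>(norm v)\<^sup>2\<close>, while
        \<open>\<gamma> * norm p \<le> norm v\<close>; one factor \<open>norm v\<close> then
        cancels.\<close>
      have "norm v * (\<gamma> * norm v) = \<gamma> * B v p"
        by (simp add: A' p power2_norm_eq_inner flip: power2_eq_square)
      also have "\<dots> \<le> norm (B v) * (\<gamma> * norm p)"
        using norm_blinfun[of "B v" p] \<gamma>(1) by auto
      also have "\<dots> \<le> norm (B v) * norm v"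
        using lower[of p] by (intro mult_left_mono) (auto simp: p)
      finally show ?thesis
        using \<gamma>(1) by (cases "v = 0") (auto simp: field_simps)
    qed
    moreover have "isomorphism_from B ((ker B)\<^sup>\<bottom>)"
      using ex by (intro isomorphism_from_orthogonal_kerI[OF _ bound]) (auto simp flip: range)
    ultimately have ?c
      using \<gamma>(1) by (auto intro!: exI[of _ "1 / \<gamma>"])
    with \<open>?a\<close> show ?thesis ..
  qed
  moreover have "?b" if ?c
  proof -
    from that obtain c where c: "0 \<le> c" "\<And>v. v \<in> (ker B)\<^sup>\<bottom> \<Longrightarrow> norm v \<le> c * norm (B v)"
      by blast
    have onto: "B ` ((ker B)\<^sup>\<bottom>) = UNIV"
      using that by (auto simp: isomorphism_from_def homeomorphism_def)
    \<comment> \<open>The witness is the preimage of the functional "inner product with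
      \<open>p\<close>", of norm at most \<open>norm p\<close>. As \<open>c\<close> may be 0,
      \<open>c + 1\<close> supplies a positive constant.\<close>
    have "\<exists>v. norm v \<le> (c + 1) * norm p \<and> (norm p)\<^sup>2 \<le> B v p" for p
    proof -
      obtain v where v: "v \<in> (ker B)\<^sup>\<bottom>" "B v = blinfun_inner_left p"
        using onto by (metis UNIV_I imageE)
      have "norm (B v) \<le> norm p"
        unfolding v(2) by (rule norm_blinfun_bound) (use Cauchy_Schwarz_ineq2[of _ p] in \<open>simp_all add: mult.commute\<close>)
      then have "c * norm (B v) \<le> (c + 1) * norm p"
        using c(1) by (intro mult_mono) auto
      with c(2)[OF v(1)] have "norm v \<le> (c + 1) * norm p"
        by linarith
      then show ?thesis
        by (auto simp: v(2) power2_norm_eq_inner)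
    qed
    then have "ereal (1 / (c + 1)) \<le> inf_sup B"
      using c(1) by (intro inf_sup_geI) auto
    then show ?b
      using c(1) by (intro exI[of _ "1 / (c + 1)"]) simp
  qed
  ultimately show ?thesis
    by blast
qed

end
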